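(* Let $v$ be a positive integer, let $S\subseteq\mathbb Z_v^+\setminus\{\frac v2\}$, and let $\mathbf h=(h_1,\ldots,h_m)\in\mathbb N^m$ and $\mathbf k=(k_1,\ldots,k_n)\in\mathbb N^n$ be such that $|S|=h_1+\cdots+h_m=k_1+\cdots+k_n$. If $$\sum_{i=1}^m\min(h_i,u)\ge\sum_{j=1}^u k'_j\quad\text{for every }1\le u\le n,$$ where $(k'_1,\ldots,k'_n)$ is the decreasing (nonincreasing) reordering of $\mathbf k$, then there exist two ($\mathbb Z_v$-regular) orthogonal path decompositions of $Cay(\mathbb Z_v;S)$ whose multisets of path-lengths are ${}^v\mathcal E(\mathbf h)$ and ${}^v\mathcal E(\mathbf k)$, respectively.
   Context: $\mathbb N=\{1,2,\dots\}$ and $\mathbb Z_v^+=\{1,\ldots,\lfloor v/2\rfloor\}\subseteq\mathbb Z_v$. $Cay(\mathbb Z_v;S)$ is the simple undirected graph with vertex set $\mathbb Z_v$ whose edges are the pairs $\{y,d+y\}$ with $y\in\mathbb Z_v$, $d\in S$. A path decomposition of a graph $\Gamma$ is a set of paths of $\Gamma$ whose edge-sets partition $E(\Gamma)$; the length of a path is its number of edges. The decomposition is $\mathbb Z_v$-regular if it is preserved by every translation $y\mapsto y+g$, $g\in\mathbb Z_v$. Two decompositions $\mathcal F,\mathcal F'$ are orthogonal if $|E(F)\cap E(F')|\le1$ for all $F\in\mathcal F$, $F'\in\mathcal F'$. $\mathcal E(\mathbf h)$ is the multiset of terms of $\mathbf h$, and ${}^vM$ is the multiset union of $v$ copies of $M$.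 *)

theory Defs
  imports Main "HOL-Library.Multiset" "HOL-Library.Disjoint_Sets"
begin

text \<open>
  Simple undirected graphs are pairs of a vertex set and a set of two-element edges;
  a path is regarded as a subgraph, so that it has no distinguished direction.
  The group of integers modulo \<open>v\<close> is represented by the naturals below \<open>v\<close>
  with addition modulo \<open>v\<close>.
\<close>

type_synonym 'a graph = "'a set \<times> 'a set set"

abbreviation verts :: "'a graph \<Rightarrow> 'a set" where
  "verts G \<equiv> fst G"

abbreviation edges :: "'a graph \<Rightarrow> 'a set set" where
  "edges G \<equiv> snd G"

definition subgraph :: "'a graph \<Rightarrow> 'a graph \<Rightarrow> bool" where
  "subgraph H G \<longleftrightarrow> verts H \<subseteq> verts G \<and> edges H \<subseteq> edges G"

definition is_path :: "'a graph \<Rightarrow> bool" where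
  "is_path P \<longleftrightarrow> (\<exists>xs. xs \<noteq> [] \<and> distinct xs \<and>
     P = (set xs, {{xs ! i, xs ! Suc i} | i. Suc i < length xs}))"

definition path_length :: "'a graph \<Rightarrow> nat" where
  "path_length P = card (edges P)"

text \<open>
  The blocks of a partition are nonempty, so every member has length at least one and is
  determined by its edge set; hence distinct members have disjoint edge sets.
\<close>

definition path_decomposition :: "'a graph \<Rightarrow> 'a graph set \<Rightarrow> bool" where
  "path_decomposition G \<F> \<longleftrightarrow>
     (\<forall>P\<in>\<F>. is_path P \<and> subgraph P G) \<and> partition_on (edges G) (edges ` \<F>)"

text \<open>
  A decomposition of a finite graph is finite, so \<open>mset_set\<close> lists each
  of its members exactly once.
\<close>

definition path_lengths :: "'a graph set \<Rightarrow> nat multiset" where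
  "path_lengths \<F> = image_mset path_length (mset_set \<F>)"

definition orthogonal_decomps :: "'a graph set \<Rightarrow> 'a graph set \<Rightarrow> bool" where
  "orthogonal_decomps \<F> \<F>' \<longleftrightarrow> (\<forall>P\<in>\<F>. \<forall>P'\<in>\<F>'. card (edges P \<inter> edges P') \<le> 1)"

definition Cay :: "nat \<Rightarrow> nat set \<Rightarrow> nat graph" where
  "Cay v S = ({..<v}, {{y, (d + y) mod v} | y d. y < v \<and> d \<in> S})"

definition translate :: "nat \<Rightarrow> nat \<Rightarrow> nat graph \<Rightarrow> nat graph" where
  "translate v g G =
     ((\<lambda>y. (y + g) mod v) ` verts G, (\<lambda>e. (\<lambda>y. (y + g) mod v) ` e) ` edges G)"

definition Zv_regular :: "nat \<Rightarrow> nat graph set \<Rightarrow> bool" where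
  "Zv_regular v \<F> \<longleftrightarrow> (\<forall>g<v. translate v g ` \<F> = \<F>)"

end

theory Submission
  imports Defs
begin

text \<open>
  By an exchange argument in the style of Gale and Ryser, the hypothesis on \<open>h\<close> and \<open>k\<close>
  yields a 0-1 matrix with row sums \<open>h\<close> and column sums \<open>k\<close>. Labelling its ones by the
  elements of \<open>S\<close> gives two partitions of \<open>S\<close>, with block sizes \<open>h\<close> and \<open>k\<close>, in which any
  two blocks from different partitions share at most one element. The elements of a block,
  taken in decreasing order and with alternating signs, are the successive differences of a
  path, and the translates of these paths decompose the Cayley graph. A path obtained in
  this way has exactly one edge for each difference in its block, whence orthogonality.
\<close>

subsection \<open>Zero-one matrices with given row and column sums\<close>

text \<open>Induction on the total surplus of the columns; truncated subtraction lets columns below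
  their target contribute 0. Moving a one within its row from a surplus column to a later deficient
  one keeps the row sum and lowers the surplus.\<close>

lemma zero_one_matrix_exchange:
  fixes R :: "nat \<Rightarrow> nat set" and k :: "nat \<Rightarrow> nat" and m n :: nat
  defines "col \<equiv> \<lambda>R j. card {i. i < m \<and> j \<in> R i}"
  assumes anti: "\<And>i j. i \<le> j \<Longrightarrow> j < n \<Longrightarrow> k j \<le> k i"
    and "\<forall>i<m. R i \<subseteq> {..<n}"
    and "\<forall>u\<le>n. sum k {..<u} \<le> sum (col R) {..<u}"
    and "sum (col R) {..<n} = sum k {..<n}"
  shows "\<exists>R'. (\<forall>i<m. R' i \<subseteq> {..<n} \<and> card (R' i) = card (R i)) \<and> (\<forall>j<n. col R' j = k j)"
  using assms(3-5)
proof (induction "\<Sum>j<n. col R j - k j" arbitrary: R rule: less_induct)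
  case less
  note sub = less.prems(1) and dom = less.prems(2) and tot = less.prems(3)
  show ?case
  proof (cases "\<exists>j<n. col R j < k j")
    case False
    then have "\<And>j. j \<in> {..<n} \<Longrightarrow> k j \<le> col R j" by (metis lessThan_iff not_less)
    from sum_mono_inv[OF tot[symmetric] this] have "k j = col R j" if "j < n" for j
      using that by simp
    then show ?thesis using sub by auto
  next
    case True
    \<comment> \<open>Taking the first deficient column means that every column to its left already
      reaches its target, which later gives slack in the prefix sums.\<close>
    define j where "j = (LEAST j. j < n \<and> col R j < k j)"
    have j: "j < n" "col R j < k j"
      using LeastI_ex[OF True[unfolded Bex_def]] unfolding j_def by auto
    have before: "k l \<le> col R l" if "l < j" for l
      using not_less_Least[of l "\<lambda>j. j < n \<and> col R j < k j"] that j(1)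
      unfolding j_def[symmetric] by (auto simp: not_less)
    \<comment> \<open>Otherwise the deficit in column \<open>j\<close> would break dominance for the
      prefix that ends with \<open>j\<close>.\<close>
    have "\<exists>i<j. k i < col R i"
    proof (rule ccontr)
      assume "\<not> ?thesis"
      then have "\<And>i. i \<in> {..<j} \<Longrightarrow> col R i \<le> k i" by (metis lessThan_iff not_less)
      then have "sum (col R) {..<j} \<le> sum k {..<j}" by (rule sum_mono)
      moreover have "sum k {..<Suc j} \<le> sum (col R) {..<Suc j}" using dom[rule_format, of "Suc j"] j(1) by simp
      ultimately show False using j(2) by simp
    qed
    then obtain i where i: "i < j" "k i < col R i" by blast
    \<comment> \<open>As \<open>k\<close> is nonincreasing,
      \<open>col R j < k j \<le> k i < col R i\<close>, so some row has a one in column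
      \<open>i\<close> and none in column \<open>j\<close>.\<close>
    have "col R j < col R i" using anti[of i j] i j by linarith
    then have "\<not> {r. r < m \<and> i \<in> R r} \<subseteq> {r. r < m \<and> j \<in> R r}"
      unfolding col_def using card_mono[of "{r. r < m \<and> j \<in> R r}" "{r. r < m \<and> i \<in> R r}"]
      by force
    then obtain r where r: "r < m" "i \<in> R r" "j \<notin> R r" by blast
    define R' where "R' = R(r := insert j (R r - {i}))"
    have "{q. q < m \<and> i \<in> R' q} = {q. q < m \<and> i \<in> R q} - {r}"
      using i(1) by (auto simp: R'_def)
    then have coli: "col R' i = col R i - 1"
      using r by (simp add: col_def)
    have "{q. q < m \<and> j \<in> R' q} = insert r {q. q < m \<and> j \<in> R q}"
      using r by (auto simp: R'_def)
    then have colj: "col R' j = Suc (col R j)"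
      using r by (simp add: col_def)
    have coll: "col R' l = col R l" if "l \<noteq> i" "l \<noteq> j" for l
      using that unfolding col_def R'_def by (auto intro!: arg_cong[where f = card])
    have fin: "finite (R r)" using sub r(1) finite_subset by blast
    have sub': "\<forall>q<m. R' q \<subseteq> {..<n}" using sub j(1) by (auto simp: R'_def)
    have card': "card (R' q) = card (R q)" for q
      using r fin i(1) card_Suc_Diff1[OF fin r(2)] by (auto simp: R'_def)
    \<comment> \<open>Only the prefixes that contain \<open>i\<close> but not \<open>j\<close>
      change. They lose one, and for exactly these \<open>strict\<close> provides a spare
      unit.\<close>
    have low: "sum (col R') {..<u} = sum (col R) {..<u}" if "u \<le> i" for u
      using that i(1) by (intro sum.cong) (auto intro!: coll)
    have mid: "Suc (sum (col R') {..<u}) = sum (col R) {..<u}" if "i < u" "u \<le> j" for u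
    proof -
      have "sum (col R') ({..<u} - {i}) = sum (col R) ({..<u} - {i})"
        using that by (intro sum.cong) (auto intro!: coll)
      then show ?thesis
        using sum.remove[of "{..<u}" i "col R"] sum.remove[of "{..<u}" i "col R'"] that coli i(2)
        by simp
    qed
    have high: "sum (col R') {..<u} = sum (col R) {..<u}" if "j < u" for u
    proof -
      have "sum (col R') ({..<u} - {i} - {j}) = sum (col R) ({..<u} - {i} - {j})"
        by (intro sum.cong) (auto intro!: coll)
      moreover have "sum f {..<u} = f i + (f j + sum f ({..<u} - {i} - {j}))" for f :: "nat \<Rightarrow> nat"
        using sum.remove[of "{..<u}" i f] sum.remove[of "{..<u} - {i}" j f] that i(1) by simp
      ultimately show ?thesis
        using coli colj i(2) by simp
    qed
    have strict: "sum k {..<u} < sum (col R) {..<u}" if "i < u" "u \<le> j" for u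
      using that i(2) before by (intro sum_strict_mono_ex1) auto
    have dom': "\<forall>u\<le>n. sum k {..<u} \<le> sum (col R') {..<u}"
    proof (intro allI impI)
      fix u assume "u \<le> n"
      consider "u \<le> i" | "i < u" "u \<le> j" | "j < u" by linarith
      then show "sum k {..<u} \<le> sum (col R') {..<u}"
        using low[of u] high[of u] mid[of u] strict[of u] dom[rule_format, OF \<open>u \<le> n\<close>] by cases auto
    qed
    have tot': "sum (col R') {..<n} = sum k {..<n}" using high[OF j(1)] tot by simp
    have "(\<Sum>l<n. col R' l - k l) < (\<Sum>l<n. col R l - k l)"
    proof (rule sum_strict_mono_ex1)
      show "\<forall>l\<in>{..<n}. col R' l - k l \<le> col R l - k l"
      proof
        fix l
        show "col R' l - k l \<le> col R l - k l"
          using coli colj coll[of l] j(2) by (cases "l = i"; cases "l = j") auto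
      qed
      show "\<exists>l\<in>{..<n}. col R' l - k l < col R l - k l"
        using i j(1) coli by (intro bexI[of _ i]) auto
    qed simp
    from less.hyps[OF this sub' dom' tot'] show ?thesis using card' by simp
  qed
qed

text \<open>The exchange starts from the left-justified matrix, whose row \<open>i\<close> has its
  ones in the first \<open>h i\<close> columns. Its first \<open>u\<close> columns contain exactly
  the sum of \<open>min (h i) u\<close> ones, so the hypothesis is the required dominance.\<close>

lemma gale_ryser:
  fixes h k :: "nat \<Rightarrow> nat"
  assumes anti: "\<And>i j. i \<le> j \<Longrightarrow> j < n \<Longrightarrow> k j \<le> k i"
    and tot: "sum h {..<m} = sum k {..<n}"
    and dom: "\<And>u. u \<le> n \<Longrightarrow> sum k {..<u} \<le> (\<Sum>i<m. min (h i) u)"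
  shows "\<exists>R. (\<forall>i<m. R i \<subseteq> {..<n} \<and> card (R i) = h i) \<and>
    (\<forall>j<n. card {i. i < m \<and> j \<in> R i} = k j)"
proof -
  \<comment> \<open>The case \<open>u = n\<close> together with equal totals leaves no room for
    truncation, so every left-justified row fits into \<open>n\<close> columns.\<close>
  have eq: "(\<Sum>i<m. min (h i) n) = sum h {..<m}"
    using dom[of n] tot by (intro antisym[OF sum_mono]) auto
  have le: "h i \<le> n" if "i < m" for i
  proof -
    have "min (h i) n = h i" using sum_mono_inv[OF eq, of i] that by simp
    then show ?thesis by linarith
  qed
  \<comment> \<open>Double counting: the ones in the first \<open>u\<close> columns are counted by
    rows instead.\<close>
  have partial: "(\<Sum>j<u. card {i. i < m \<and> j \<in> {..<h i}}) = (\<Sum>i<m. min (h i) u)" for u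
  proof -
    have "(\<Sum>j<u. card {i. i < m \<and> j \<in> {..<h i}}) = (\<Sum>j<u. \<Sum>i<m. if j < h i then 1 else 0)"
      by (intro sum.cong) (simp_all add: sum.If_cases Int_def)
    also have "\<dots> = (\<Sum>i<m. \<Sum>j<u. if j < h i then 1 else 0)" by (rule sum.swap)
    also have "\<dots> = (\<Sum>i<m. min (h i) u)"
    proof (intro sum.cong refl)
      fix i
      have "{..<u} \<inter> {j. j < h i} = {..<min (h i) u}" by auto
      then show "(\<Sum>j<u. if j < h i then 1 else 0) = min (h i) u" by (simp add: sum.If_cases)
    qed
    finally show ?thesis .
  qed
  have "\<exists>R'. (\<forall>i<m. R' i \<subseteq> {..<n} \<and> card (R' i) = card {..<h i}) \<and>
      (\<forall>j<n. card {i. i < m \<and> j \<in> R' i} = k j)"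
  proof (rule zero_one_matrix_exchange[OF anti])
    show "\<forall>i<m. {..<h i} \<subseteq> {..<n}" using le by auto
    show "\<forall>u\<le>n. sum k {..<u} \<le> (\<Sum>j<u. card {i. i < m \<and> j \<in> {..<h i}})"
      using dom partial by simp
    show "(\<Sum>j<n. card {i. i < m \<and> j \<in> {..<h i}}) = sum k {..<n}"
      using partial[of n] le tot by (simp add: min_absorb1)
  qed
  then show ?thesis by simp
qed

subsection \<open>Zigzag paths\<close>

definition path_edges :: "'a list \<Rightarrow> 'a set set" where
  "path_edges xs = {{xs ! i, xs ! Suc i} | i. Suc i < length xs}"

lemma path_edges_simps [simp]:
  "path_edges [] = {}" "path_edges [x] = {}"
  "path_edges (x # y # zs) = insert {x, y} (path_edges (y # zs))"
proof -
  show "path_edges (x # y # zs) = insert {x, y} (path_edges (y # zs))" (is "?A = ?B")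
  proof
    show "?A \<subseteq> ?B"
    proof
      fix e assume "e \<in> ?A"
      then obtain i where "Suc i < length (x # y # zs)"
        "e = {(x # y # zs) ! i, (x # y # zs) ! Suc i}"
        unfolding path_edges_def by blast
      then show "e \<in> ?B" by (cases i) (auto simp: path_edges_def)
    qed
    have "{(y # zs) ! i, (y # zs) ! Suc i} \<in> ?A" if "Suc i < length (y # zs)" for i
      unfolding path_edges_def using that by (intro CollectI exI[of _ "Suc i"]) auto
    moreover have "{x, y} \<in> ?A" unfolding path_edges_def by (intro CollectI exI[of _ 0]) auto
    ultimately show "?B \<subseteq> ?A" unfolding path_edges_def[of "y # zs"] by blast
  qed
qed (simp_all add: path_edges_def)

lemma path_edges_map: "path_edges (map f xs) = (`) f ` path_edges xs"
  by (induction xs rule: induct_list012) auto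

lemma is_path_iff:
  "is_path P \<longleftrightarrow> (\<exists>xs. xs \<noteq> [] \<and> distinct xs \<and> P = (set xs, path_edges xs))"
  unfolding is_path_def path_edges_def ..

text \<open>
  If the largest difference \<open>b\<close> occurs in \<open>A\<close>, the path for the other differences is reflected
  into \<open>{1..b}\<close>, where it starts at \<open>b\<close>, and is then extended by the edge from \<open>0\<close> to \<open>b\<close>.
\<close>

lemma zigzag_path:
  fixes A :: "nat set"
  assumes "A \<subseteq> {1..b}"
  shows "\<exists>xs c. distinct (0 # xs) \<and> set xs \<subseteq> {..b} \<and> (\<forall>d\<in>A. c d + d \<le> b) \<and>
    path_edges (0 # xs) = (\<lambda>d. {c d, c d + d}) ` A"
  using assms
proof (induction b arbitrary: A)
  case 0
  then show ?case by (intro exI[of _ "[]"]) auto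
next
  case (Suc b)
  have "A - {Suc b} \<subseteq> {1..b}" using Suc.prems by (auto simp: le_Suc_eq)
  from Suc.IH[OF this] obtain xs c where xs: "distinct (0 # xs)" "set xs \<subseteq> {..b}"
    and c: "\<forall>d\<in>A - {Suc b}. c d + d \<le> b"
    and e: "path_edges (0 # xs) = (\<lambda>d. {c d, c d + d}) ` (A - {Suc b})"
    by blast
  show ?case
  proof (cases "Suc b \<in> A")
    case False
    then have "A - {Suc b} = A" by simp
    then show ?thesis using xs c e
      by (intro exI[of _ xs] exI[of _ c]) (auto simp: le_Suc_eq)
  next
    case True
    define f where "f = (\<lambda>x. Suc b - x)"
    \<comment> \<open>Reflection exchanges the lower and upper endpoints of an edge, so the new
      lower endpoint is the image of the old upper one. The added edge of difference
      \<open>Suc b\<close> starts at 0.\<close>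
    define c' where "c' = (\<lambda>d. if d = Suc b then 0 else f (c d + d))"
    have inj: "inj_on f (set (0 # xs))"
      using xs(2) by (auto simp: inj_on_def f_def)
    \<comment> \<open>The old vertices are at most \<open>b\<close>, so their reflections are
      positive and 0 is a new vertex.\<close>
    have "distinct (0 # map f (0 # xs))"
      using inj xs distinct_map[of f "0 # xs"] by (auto simp: f_def)
    moreover have "set (map f (0 # xs)) \<subseteq> {..Suc b}" by (auto simp: f_def)
    moreover have "\<forall>d\<in>A. c' d + d \<le> Suc b" using c by (force simp: c'_def f_def)
    moreover have "path_edges (0 # map f (0 # xs)) = (\<lambda>d. {c' d, c' d + d}) ` A"
    proof -
      have "f ` {c d, c d + d} = {c' d, c' d + d}" if "d \<in> A - {Suc b}" for d
        using c that by (force simp: c'_def f_def)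
      then have "path_edges (map f (0 # xs)) = (\<lambda>d. {c' d, c' d + d}) ` (A - {Suc b})"
        unfolding path_edges_map e image_image by (intro image_cong) auto
      then have "path_edges (0 # map f (0 # xs)) =
          insert {c' (Suc b), c' (Suc b) + Suc b} ((\<lambda>d. {c' d, c' d + d}) ` (A - {Suc b}))"
        by (simp add: c'_def f_def)
      also have "\<dots> = (\<lambda>d. {c' d, c' d + d}) ` A" using True by blast
      finally show ?thesis .
    qed
    ultimately show ?thesis by blast
  qed
qed

subsection \<open>Path decompositions of Cayley graphs from partitions of the connection set\<close>

definition cedge :: "nat \<Rightarrow> nat \<Rightarrow> nat \<Rightarrow> nat set" where
  "cedge v d y = {y, (d + y) mod v}"

text \<open>Reading the same edge from its other end would give \<open>d + d'\<close> divisible by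
  \<open>v\<close>, which is impossible because \<open>0 < d + d' < v\<close>. Hence an edge has a
  well-defined difference and base point.\<close>

lemma cedge_inject:
  assumes "0 < d" "2 * d < v" "0 < d'" "2 * d' < v" "y < v" "z < v"
    and eq: "cedge v d y = cedge v d' z"
  shows "d = d' \<and> y = z"
proof -
  have sum_mod: "(d + y) mod v = (if d + y < v then d + y else d + y - v)"
    "(d' + z) mod v = (if d' + z < v then d' + z else d' + z - v)"
    using assms(1-6) by (auto simp: mod_if)
  show ?thesis
    using eq assms(1-6) unfolding cedge_def sum_mod doubleton_eq_iff
    by (auto split: if_splits)
qed

lemma translate_cedge:
  "(\<lambda>y. (y + g) mod v) ` cedge v d y = cedge v d ((y + g) mod v)"
  by (simp add: cedge_def mod_simps ac_simps)

lemma translate_translate: "translate v g (translate v g' P) = translate v ((g + g') mod v) P"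
  by (simp add: translate_def image_image mod_simps ac_simps)

lemma inj_on_add_mod: "inj_on (\<lambda>y. (y + g) mod v) {..<v::nat}"
proof (rule inj_onI)
  fix x y assume "x \<in> {..<v}" "y \<in> {..<v}" "(x + g) mod v = (y + g) mod v"
  then have "x mod v = y mod v" unfolding nat_mod_eq_iff by auto
  then show "x = y" using \<open>x \<in> {..<v}\<close> \<open>y \<in> {..<v}\<close> by simp
qed

lemma is_path_translate:
  assumes "is_path P" "verts P \<subseteq> {..<v}"
  shows "is_path (translate v g P)"
proof -
  from assms obtain xs where xs: "xs \<noteq> []" "distinct xs" "P = (set xs, path_edges xs)"
    unfolding is_path_iff by blast
  have "inj_on (\<lambda>y. (y + g) mod v) (set xs)"
    using inj_on_subset[OF inj_on_add_mod] assms(2) xs(3) by simp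
  then show ?thesis
    unfolding is_path_iff using xs
    by (intro exI[of _ "map (\<lambda>y. (y + g) mod v) xs"])
      (auto simp: distinct_map translate_def path_edges_map)
qed

text \<open>The zigzag stays within \<open>{..v div 2}\<close>, below \<open>v\<close>, so no sum
  wraps around and integer differences serve as differences modulo \<open>v\<close>.\<close>

lemma base_path:
  assumes "0 < v" "A \<subseteq> {1..v div 2}"
  shows "\<exists>P c. is_path P \<and> verts P \<subseteq> {..<v} \<and> (\<forall>d\<in>A. c d < v) \<and>
    edges P = (\<lambda>d. cedge v d (c d)) ` A"
proof -
  from zigzag_path[OF assms(2)] obtain xs c where xs: "distinct (0 # xs)"
    "set xs \<subseteq> {..v div 2}" and c: "\<forall>d\<in>A. c d + d \<le> v div 2"
    and e: "path_edges (0 # xs) = (\<lambda>d. {c d, c d + d}) ` A"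
    by blast
  have less: "x < v" if "x \<le> v div 2" for x using that assms(1) by linarith
  have "{c d, c d + d} = cedge v d (c d)" if "d \<in> A" for d
    using less[of "c d + d"] c that by (simp add: cedge_def add.commute)
  then have "path_edges (0 # xs) = (\<lambda>d. cedge v d (c d)) ` A" unfolding e by (intro image_cong) auto
  moreover have "set (0 # xs) \<subseteq> {..<v}" using xs(2) less assms(1) by auto
  moreover have "\<forall>d\<in>A. c d < v" using c less by (meson add_leD1)
  moreover have "is_path (set (0 # xs), path_edges (0 # xs))"
    unfolding is_path_iff using xs(1) by blast
  ultimately show ?thesis by (metis fst_conv snd_conv)
qed

text \<open>The members are all translates of one base path per block. The difference of an edge
  selects the block, and its base point then selects the translate, so every edge is used once. The
  final conclusion, one edge for each difference of a block, is recorded for orthogonality.\<close>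

lemma regular_path_decomposition:
  fixes A :: "nat \<Rightarrow> nat set"
  assumes "0 < v" and S: "S \<subseteq> {1..v div 2} - {d. 2 * d = v}"
    and cover: "(\<Union>i<m. A i) = S"
    and disj: "disjoint_family_on A {..<m}"
    and nonempty: "\<And>i. i < m \<Longrightarrow> A i \<noteq> {}"
  shows "\<exists>\<F>. path_decomposition (Cay v S) \<F> \<and> Zv_regular v \<F> \<and>
    path_lengths \<F> = repeat_mset v (mset (map (\<lambda>i. card (A i)) [0..<m])) \<and>
    (\<forall>P\<in>\<F>. \<exists>i<m. \<exists>c. (\<forall>d\<in>A i. c d < v) \<and> edges P = (\<lambda>d. cedge v d (c d)) ` A i)"
proof -
  have "\<exists>P c. is_path P \<and> verts P \<subseteq> {..<v} \<and> (\<forall>d\<in>A i. c d < v) \<and>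
    edges P = (\<lambda>d. cedge v d (c d)) ` A i" if "i < m" for i
    using that cover S by (intro base_path assms) blast
  then obtain P c where P: "\<And>i. i < m \<Longrightarrow> is_path (P i)" "\<And>i. i < m \<Longrightarrow> verts (P i) \<subseteq> {..<v}"
    and c: "\<And>i d. i < m \<Longrightarrow> d \<in> A i \<Longrightarrow> c i d < v"
    and edges_P: "\<And>i. i < m \<Longrightarrow> edges (P i) = (\<lambda>d. cedge v d (c i d)) ` A i"
    by metis
  have A_subset: "A i \<subseteq> S" if "i < m" for i using that cover by blast
  have S_bounds: "0 < d" "2 * d < v" if "d \<in> S" for d
    using that S by (auto simp: subset_iff dest: bspec)
  have inject: "d = d' \<and> y = z"
    if "cedge v d y = cedge v d' z" "d \<in> S" "d' \<in> S" "y < v" "z < v" for d d' y z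
    using cedge_inject[of d v d' y z] S_bounds(1,2)[of d] S_bounds(1,2)[of d'] that by simp
  define I where "I = {..<m} \<times> {..<v}"
  define T where "T = (\<lambda>(i, g). translate v g (P i))"
  have edges_T: "edges (T (i, g)) = (\<lambda>d. cedge v d ((c i d + g) mod v)) ` A i" if "i < m" for i g
    by (simp add: T_def translate_def edges_P[OF that] image_image translate_cedge)
  \<comment> \<open>A common edge fixes its difference, hence the block by disjointness, and then
    the shift by cancelling \<open>c i d\<close>. This yields both the injectivity of
    \<open>T\<close> and the disjointness of the edge sets.\<close>
  have meet: "(i, g) = (i', g')"
    if "(i, g) \<in> I" "(i', g') \<in> I" "e \<in> edges (T (i, g))" "e \<in> edges (T (i', g'))" for i g i' g' e
  proof -
    have im: "i < m" "i' < m" "g < v" "g' < v" using that by (auto simp: I_def)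
    from that im obtain d d' where d: "d \<in> A i" "d' \<in> A i'"
      "cedge v d ((c i d + g) mod v) = cedge v d' ((c i' d' + g') mod v)"
      by (auto simp: edges_T)
    then have "d = d'" and eq: "(c i d + g) mod v = (c i' d' + g') mod v"
      using inject[OF d(3)] A_subset im \<open>0 < v\<close> by auto
    moreover from this have "i = i'"
      using d im disj unfolding disjoint_family_on_def by blast
    ultimately have "(g + c i d) mod v = (g' + c i d) mod v" by (simp add: add.commute)
    then have "g = g'" using inj_on_add_mod[of "c i d" v] im by (auto dest: inj_onD)
    with \<open>i = i'\<close> show ?thesis by simp
  qed
  have edges_nonempty: "edges (T p) \<noteq> {}" if "p \<in> I" for p
    using that nonempty edges_T by (auto simp: I_def)
  \<comment> \<open>Equal members would share an edge, as no edge set is empty. So the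
    \<open>v\<close> translates of a base path are distinct, which gives the multiplicity
    \<open>v\<close> of the lengths.\<close>
  have inj: "inj_on T I"
  proof (rule inj_onI)
    fix p q assume pq: "p \<in> I" "q \<in> I" "T p = T q"
    from edges_nonempty[OF pq(1)] obtain e where "e \<in> edges (T p)" by blast
    then show "p = q" using meet[of "fst p" "snd p" "fst q" "snd q" e] pq by simp
  qed
  have edges_Cay: "edges (Cay v S) = (\<Union>y<v. (\<lambda>d. cedge v d y) ` S)"
    unfolding Cay_def cedge_def by auto
  have union: "(\<Union>p\<in>I. edges (T p)) = edges (Cay v S)"
  proof
    show "(\<Union>p\<in>I. edges (T p)) \<subseteq> edges (Cay v S)"
      unfolding edges_Cay using A_subset \<open>0 < v\<close>
      by (fastforce simp: I_def edges_T)
    show "edges (Cay v S) \<subseteq> (\<Union>p\<in>I. edges (T p))"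
    proof
      fix e assume "e \<in> edges (Cay v S)"
      then obtain y d where e: "e = cedge v d y" "y < v" "d \<in> S" unfolding edges_Cay by blast
      then obtain i where i: "i < m" "d \<in> A i" using cover by blast
      \<comment> \<open>This shift carries the base point \<open>c i d\<close> to \<open>y\<close>;
        the subtraction is not truncated because \<open>c i d < v\<close>.\<close>
      define g where "g = (y + (v - c i d)) mod v"
      have "(c i d + g) mod v = (c i d + (y + (v - c i d))) mod v"
        unfolding g_def by (simp add: mod_simps)
      also have "c i d + (y + (v - c i d)) = y + v" using c[OF i] by simp
      finally have "(c i d + g) mod v = y" using e(2) by simp
      then have "e \<in> edges (T (i, g))" using i e by (auto simp: edges_T)
      moreover have "(i, g) \<in> I" using i \<open>0 < v\<close> by (simp add: I_def g_def)
      ultimately show "e \<in> (\<Union>p\<in>I. edges (T p))" by blast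
    qed
  qed
  have T_path: "is_path (T p) \<and> subgraph (T p) (Cay v S)" if "p \<in> I" for p
  proof -
    obtain i g where p: "p = (i, g)" "i < m" "g < v" using \<open>p \<in> I\<close> unfolding I_def by blast
    have "is_path (T p)" using is_path_translate P p by (simp add: T_def)
    moreover have "verts (T p) \<subseteq> verts (Cay v S)"
      using \<open>0 < v\<close> p by (auto simp: T_def translate_def Cay_def)
    moreover have "edges (T p) \<subseteq> edges (Cay v S)" using union that by blast
    ultimately show ?thesis by (simp add: subgraph_def)
  qed
  have "disjoint (edges ` T ` I)"
  proof (rule disjointI)
    fix a b assume "a \<in> edges ` T ` I" "b \<in> edges ` T ` I" "a \<noteq> b"
    then obtain p q where pq: "p \<in> I" "q \<in> I" "a = edges (T p)" "b = edges (T q)" "p \<noteq> q"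
      by blast
    then show "a \<inter> b = {}" using meet[of "fst p" "snd p" "fst q" "snd q"] by auto
  qed
  moreover have "\<Union> (edges ` T ` I) = edges (Cay v S)" using union by (simp add: image_image)
  moreover have "{} \<notin> edges ` T ` I"
  proof
    assume "{} \<in> edges ` T ` I"
    then obtain p where "p \<in> I" "edges (T p) = {}" by (elim imageE) simp
    then show False using edges_nonempty by blast
  qed
  ultimately have "partition_on (edges (Cay v S)) (edges ` T ` I)"
    unfolding partition_on_def by blast
  then have decomp: "path_decomposition (Cay v S) (T ` I)"
    unfolding path_decomposition_def using T_path by blast
  have "translate v g ` T ` I = T ` I" if "g < v" for g
  proof
    show "translate v g ` T ` I \<subseteq> T ` I"
    proof
      fix Q assume "Q \<in> translate v g ` T ` I"
      then obtain i g' where Q: "Q = translate v g (T (i, g'))" "i < m" by (auto simp: I_def)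
      then have "Q = T (i, (g + g') mod v)" by (simp add: T_def translate_translate)
      moreover have "(i, (g + g') mod v) \<in> I" using Q(2) \<open>0 < v\<close> by (simp add: I_def)
      ultimately show "Q \<in> T ` I" by blast
    qed
    show "T ` I \<subseteq> translate v g ` T ` I"
    proof
      fix Q assume "Q \<in> T ` I"
      then obtain i g' where Q: "Q = translate v g' (P i)" "i < m" "g' < v"
        by (auto simp: T_def I_def)
      \<comment> \<open>Here \<open>v - g\<close> stands for the inverse of \<open>g\<close>, so
        translation by \<open>g\<close> undoes the change of shift.\<close>
      define q where "q = (g' + (v - g)) mod v"
      have "(g + q) mod v = (g + (g' + (v - g))) mod v" unfolding q_def by (simp add: mod_simps)
      also have "g + (g' + (v - g)) = g' + v" using that by simp
      finally have "(g + q) mod v = g'" using Q(3) by simp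
      then have "Q = translate v g (T (i, q))" by (simp add: T_def translate_translate Q(1))
      moreover have "(i, q) \<in> I" using Q(2) \<open>0 < v\<close> by (simp add: I_def q_def)
      ultimately show "Q \<in> translate v g ` T ` I" by blast
    qed
  qed
  then have regular: "Zv_regular v (T ` I)" unfolding Zv_regular_def by blast
  have len: "path_length (T p) = card (A (fst p))" if "p \<in> I" for p
  proof -
    obtain i g where p: "p = (i, g)" "i < m" "g < v" using \<open>p \<in> I\<close> unfolding I_def by blast
    have "inj_on (\<lambda>d. cedge v d ((c i d + g) mod v)) (A i)"
      using inject A_subset[OF p(2)] \<open>0 < v\<close> by (intro inj_onI) (meson mod_less_divisor subsetD)
    then show ?thesis by (simp add: path_length_def p edges_T card_image)
  qed
  have "path_lengths (T ` I) = image_mset (\<lambda>p. card (A (fst p))) (mset_set I)"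
    unfolding path_lengths_def image_mset_mset_set[OF inj, symmetric] image_mset.compositionality
    using len by (intro image_mset_cong) (auto simp: I_def)
  also have "\<dots> = repeat_mset v (mset (map (\<lambda>i. card (A i)) [0..<m]))"
    unfolding I_def
  \<comment> \<open>The last index is split off: its \<open>v\<close> shifts contribute
    \<open>v\<close> copies of one length.\<close>
  proof (induction m)
    case (Suc m)
    have "{..<Suc m} \<times> {..<v} = {..<m} \<times> {..<v} \<union> Pair m ` {..<v}"
      by (auto simp: less_Suc_eq)
    then have "mset_set ({..<Suc m} \<times> {..<v}) =
        mset_set ({..<m} \<times> {..<v}) + image_mset (Pair m) (mset_set {..<v})"
      by (subst image_mset_mset_set) (auto simp: inj_on_def intro!: mset_set_Union)
    then show ?case using Suc
      by (simp add: image_mset.compositionality comp_def image_mset_const_eq)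
  qed simp
  finally have lengths: "path_lengths (T ` I) = \<dots>" .
  have "\<exists>i<m. \<exists>c. (\<forall>d\<in>A i. c d < v) \<and> edges Q = (\<lambda>d. cedge v d (c d)) ` A i" if "Q \<in> T ` I" for Q
  proof -
    obtain i g where Q: "Q = T (i, g)" "i < m" using \<open>Q \<in> T ` I\<close> by (auto simp: I_def)
    then show ?thesis
      using edges_T \<open>0 < v\<close> by (intro exI[of _ i] conjI exI[of _ "\<lambda>d. (c i d + g) mod v"]) auto
  qed
  with decomp regular lengths show ?thesis by blast
qed


section \<open>Two orthogonal decompositions from a labelled zero-one matrix\<close>

theorem theorem6p10:
  fixes v m n :: nat and S :: "nat set" and h k :: "nat list"
  assumes "v \<ge> 1"
    and "S \<subseteq> {1..v div 2} - {d. 2 * d = v}"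
    and "length h = m" and "\<forall>x\<in>set h. x \<ge> 1"
    and "length k = n" and "\<forall>x\<in>set k. x \<ge> 1"
    and "card S = (\<Sum>i<m. h ! i)"
    and "card S = (\<Sum>j<n. k ! j)"
    and "\<forall>u\<in>{1..n}. (\<Sum>i<m. min (h ! i) u) \<ge> (\<Sum>j<u. rev (sort k) ! j)"
  shows "\<exists>\<F> \<F>'. path_decomposition (Cay v S) \<F> \<and> path_decomposition (Cay v S) \<F>' \<and>
           Zv_regular v \<F> \<and> Zv_regular v \<F>' \<and>
           orthogonal_decomps \<F> \<F>' \<and>
           path_lengths \<F> = repeat_mset v (mset h) \<and>
           path_lengths \<F>' = repeat_mset v (mset k)"
proof -
  \<comment> \<open>Sorting provides the monotonicity that the matrix lemma needs and keeps the
    multiset of lengths.\<close>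
  define k' where "k' = rev (sort k)"
  have len': "length k' = n" using assms(5) by (simp add: k'_def)
  have mset': "mset k' = mset k" by (simp add: k'_def)
  have sum_k': "(\<Sum>j<n. k' ! j) = card S"
    using assms(5,8) len' mset' sum_mset_sum_list[of k] sum_mset_sum_list[of k']
    by (simp add: sum_list_sum_nth atLeast0LessThan)
  have anti: "k' ! j \<le> k' ! i" if "i \<le> j" "j < n" for i j
    using that len' sorted_rev_nth_mono[of k' i j] by (simp add: k'_def)
  have tot: "(\<Sum>i<m. h ! i) = (\<Sum>j<n. k' ! j)" using assms(7) sum_k' by simp
  have dom: "(\<Sum>j<u. k' ! j) \<le> (\<Sum>i<m. min (h ! i) u)" if "u \<le> n" for u
    using that assms(9) by (cases "u = 0") (auto simp: k'_def)
  from gale_ryser[of n "(!) k'" "(!) h" m, OF anti tot dom]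
  obtain R where R: "\<And>i. i < m \<Longrightarrow> R i \<subseteq> {..<n}"
    "\<And>i. i < m \<Longrightarrow> card (R i) = h ! i" "\<And>j. j < n \<Longrightarrow> card {i. i < m \<and> j \<in> R i} = k' ! j"
    by auto
  \<comment> \<open>\<open>D\<close> is the set of positions of ones. It has as many elements as
    \<open>S\<close>, so any bijection \<phi> labels the ones by differences.\<close>
  define D where "D = (SIGMA i:{..<m}. R i)"
  have finR: "finite (R i)" if "i < m" for i using R(1)[OF that] finite_subset by blast
  have "card D = card S" using finR R(2) assms(7) by (simp add: D_def)
  moreover have "finite S" using assms(2) finite_subset by blast
  moreover have "finite D" using finR by (auto simp: D_def)
  ultimately obtain \<phi> where \<phi>: "bij_betw \<phi> S D" by (metis finite_same_card_bij)
  \<comment> \<open>\<open>A i\<close> collects the labels in row \<open>i\<close> and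
    \<open>B j\<close> those in column \<open>j\<close>, so the block sizes are the row and column
    sums.\<close>
  define A where "A = (\<lambda>i. {d \<in> S. fst (\<phi> d) = i})"
  define B where "B = (\<lambda>j. {d \<in> S. snd (\<phi> d) = j})"
  have \<phi>_in: "fst (\<phi> d) < m" "snd (\<phi> d) < n" if "d \<in> S" for d
    using bij_betwE[OF \<phi>] that R(1) by (fastforce simp: D_def)+
  have preimage: "card {d \<in> S. Q (\<phi> d)} = card {p \<in> D. Q p}" for Q
  proof -
    have im: "\<phi> ` {d \<in> S. Q (\<phi> d)} = {p \<in> D. Q p}"
      unfolding bij_betw_imp_surj_on[OF \<phi>, symmetric] by blast
    have "inj_on \<phi> {d \<in> S. Q (\<phi> d)}"
      using bij_betw_imp_inj_on[OF \<phi>] by (rule inj_on_subset) blast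
    then show ?thesis unfolding im[symmetric] by (rule card_image[symmetric])
  qed
  have cardA: "card (A i) = h ! i" if "i < m" for i
  proof -
    have "{p \<in> D. fst p = i} = Pair i ` R i" using that by (auto simp: D_def)
    then show ?thesis
      using preimage[of "\<lambda>p. fst p = i"] R(2)[OF that]
      by (simp add: A_def card_image inj_on_def)
  qed
  have cardB: "card (B j) = k' ! j" if "j < n" for j
  proof -
    have "{p \<in> D. snd p = j} = (\<lambda>i. (i, j)) ` {i. i < m \<and> j \<in> R i}" by (auto simp: D_def)
    then show ?thesis
      using preimage[of "\<lambda>p. snd p = j"] R(3)[OF that]
      by (simp add: B_def card_image inj_on_def)
  qed
  have "0 < v" using assms(1) by simp
  have partA: "(\<Union>i<m. A i) = S" "disjoint_family_on A {..<m}"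
    using \<phi>_in by (auto simp: A_def disjoint_family_on_def)
  have nonemptyA: "A i \<noteq> {}" if "i < m" for i
  proof -
    have "h ! i \<in> set h" using that assms(3) by simp
    then show ?thesis using cardA[OF that] assms(4) by fastforce
  qed
  obtain \<F> where F: "path_decomposition (Cay v S) \<F>" "Zv_regular v \<F>"
    "path_lengths \<F> = repeat_mset v (mset (map (\<lambda>i. card (A i)) [0..<m]))"
    and F_edges: "\<forall>P\<in>\<F>. \<exists>i<m. \<exists>c. (\<forall>d\<in>A i. c d < v) \<and> edges P = (\<lambda>d. cedge v d (c d)) ` A i"
    using regular_path_decomposition[OF \<open>0 < v\<close> assms(2) partA nonemptyA] by auto
  have partB: "(\<Union>j<n. B j) = S" "disjoint_family_on B {..<n}"
    using \<phi>_in by (auto simp: B_def disjoint_family_on_def)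
  have nonemptyB: "B j \<noteq> {}" if "j < n" for j
  proof -
    have "k' ! j \<in> set k" using that len' mset' by (metis nth_mem mset_eq_setD)
    then show ?thesis using cardB[OF that] assms(6) by fastforce
  qed
  obtain \<F>' where F': "path_decomposition (Cay v S) \<F>'" "Zv_regular v \<F>'"
    "path_lengths \<F>' = repeat_mset v (mset (map (\<lambda>j. card (B j)) [0..<n]))"
    and F'_edges: "\<forall>P\<in>\<F>'. \<exists>j<n. \<exists>c. (\<forall>d\<in>B j. c d < v) \<and> edges P = (\<lambda>d. cedge v d (c d)) ` B j"
    using regular_path_decomposition[OF \<open>0 < v\<close> assms(2) partB nonemptyB] by auto
  have mapA: "map (\<lambda>i. card (A i)) [0..<m] = h"
    using cardA assms(3) by (intro nth_equalityI) auto
  have mapB: "map (\<lambda>j. card (B j)) [0..<n] = k'"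
    using cardB len' by (intro nth_equalityI) auto
  \<comment> \<open>A row and a column meet in a single cell, which carries at most one
    label.\<close>
  have AB: "d = d'" if "d \<in> A i \<inter> B j" "d' \<in> A i \<inter> B j" for d d' i j
  proof -
    have "\<phi> d = \<phi> d'" "d \<in> S" "d' \<in> S" using that by (auto simp: A_def B_def intro: prod_eqI)
    then show ?thesis using bij_betw_imp_inj_on[OF \<phi>] by (auto dest: inj_onD)
  qed
  have S_bounds: "0 < d \<and> 2 * d < v" if "d \<in> S" for d
  proof -
    have "1 \<le> d" "d \<le> v div 2" "2 * d \<noteq> v" using that assms(2) by auto
    then show ?thesis by linarith
  qed
  have "orthogonal_decomps \<F> \<F>'"
    unfolding orthogonal_decomps_def
  proof (intro ballI)
    fix P P' assume P: "P \<in> \<F>" and P': "P' \<in> \<F>'"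
    from bspec[OF F_edges P] obtain i c
      where c: "\<forall>d\<in>A i. c d < v" "edges P = (\<lambda>d. cedge v d (c d)) ` A i"
      by auto
    from bspec[OF F'_edges P'] obtain j c'
      where c': "\<forall>d\<in>B j. c' d < v" "edges P' = (\<lambda>d. cedge v d (c' d)) ` B j"
      by auto
    \<comment> \<open>By \<open>cedge_inject\<close> a common edge has one and the same difference
      in both paths, which therefore lies in both blocks. By \<open>AB\<close> only one difference
      does, and in \<open>P\<close> it occurs on only one edge.\<close>
    have "\<exists>d\<in>A i \<inter> B j. e = cedge v d (c d)" if "e \<in> edges P \<inter> edges P'" for e
    proof -
      from that c c' obtain d d' where d: "d \<in> A i" "e = cedge v d (c d)"
        "d' \<in> B j" "e = cedge v d' (c' d')" by auto
      then have "d \<in> S" "d' \<in> S" by (auto simp: A_def B_def)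
      then have "d = d'"
        using cedge_inject[of d v d' "c d" "c' d'"] S_bounds c(1) c'(1) d by auto
      then show ?thesis using d by blast
    qed
    then have "e = e'" if "e \<in> edges P \<inter> edges P'" "e' \<in> edges P \<inter> edges P'" for e e'
      using that AB[of _ i j] by metis
    moreover have "finite (edges P \<inter> edges P')"
      using \<open>finite S\<close> c(2) by (simp add: A_def)
    ultimately show "card (edges P \<inter> edges P') \<le> 1"
      by (simp add: card_le_Suc0_iff_eq)
  qed
  then show ?thesis
    using F F' unfolding mapA mapB mset' by blast
qed

end
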